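(* Let $G = K \rtimes H$ be a finite Frobenius group with Frobenius kernel $K$ and Frobenius complement $H$, and suppose $H$ acts regularly (sharply transitively) by conjugation on the nonidentity elements of $K$. Let $t \ge 0$ and let $S$ be the union of $t$ distinct left cosets of $H$ in $G$, each different from $H$. Then $S$ is a $(|G|, t|H|, t^2 - t, t^2)$ partial sum set in $G$, and $S \cup H$ is a $(|G|, (t+1)|H|, t^2 + |H|, t^2 + t)$ partial sum set in $G$.
   Context: A finite group $G$ with a subgroup $H$ is a Frobenius group with Frobenius complement $H$ if $N_G(H) = H$ and $g_1^{-1}Hg_1 \cap g_2^{-1}Hg_2 = \{1\}$ whenever these two conjugates are distinct; then there is a proper nontrivial normal subgroup $K$ (the Frobenius kernel) with $G = K \rtimes H$. For a finite group $X$ of order $w$ and $T\subseteq X$ with $|T|=k$, the number of ways to write $a \in X$ as a product in $T$ is the number of ordered pairs $(y_1,y_2)\in T\times T$ with $y_1y_2=a$. $T$ is a $(w,k,\lambda,\mu)$ partial sum set if every nonidentity element of $T$ is a product in $T$ in exactly $\lambda$ ways and every nonidentity element of $X\setminus T$ is a product in $T$ in exactly $\mu$ ways. *)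

theory Defs
  imports "HOL-Algebra.Algebra"
begin

definition conj_set :: "('a, 'b) monoid_scheme \<Rightarrow> 'a set \<Rightarrow> 'a \<Rightarrow> 'a set"
  where "conj_set G H g = inv\<^bsub>G\<^esub> g <#\<^bsub>G\<^esub> H #>\<^bsub>G\<^esub> g"

definition frobenius_complement :: "('a, 'b) monoid_scheme \<Rightarrow> 'a set \<Rightarrow> bool"
  where "frobenius_complement G H \<longleftrightarrow>
    group G \<and> finite (carrier G) \<and> subgroup H G \<and>
    normalizer G H = H \<and>
    (\<forall>g1\<in>carrier G. \<forall>g2\<in>carrier G. conj_set G H g1 \<noteq> conj_set G H g2 \<longrightarrow>
       conj_set G H g1 \<inter> conj_set G H g2 = {\<one>\<^bsub>G\<^esub>})"

definition internal_semidirect :: "('a, 'b) monoid_scheme \<Rightarrow> 'a set \<Rightarrow> 'a set \<Rightarrow> bool"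
  where "internal_semidirect G K H \<longleftrightarrow>
    K \<lhd> G \<and> subgroup H G \<and> K <#>\<^bsub>G\<^esub> H = carrier G \<and> K \<inter> H = {\<one>\<^bsub>G\<^esub>}"

text \<open>The Frobenius kernel is introduced as a proper nontrivial normal complement of \<open>H\<close>.
  This determines \<open>K\<close>: a normal complement meets every conjugate of \<open>H\<close> trivially, hence consists
  of \<open>\<one>\<close> and the elements lying in no conjugate of \<open>H\<close>. Properness and nontriviality of \<open>K\<close> also
  exclude the degenerate cases where \<open>H\<close> is trivial or all of \<open>G\<close>.\<close>

definition frobenius_group :: "('a, 'b) monoid_scheme \<Rightarrow> 'a set \<Rightarrow> 'a set \<Rightarrow> bool"
  where "frobenius_group G K H \<longleftrightarrow>
    frobenius_complement G H \<and> internal_semidirect G K H \<and>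
    K \<noteq> {\<one>\<^bsub>G\<^esub>} \<and> K \<noteq> carrier G"

text \<open>The action is the right action \<open>x \<mapsto> h\<^sup>-\<^sup>1 x h\<close>; replacing \<open>h\<close> by its inverse gives the same condition
  for \<open>x \<mapsto> h x h\<^sup>-\<^sup>1\<close>.\<close>

definition acts_regularly_by_conjugation ::
    "('a, 'b) monoid_scheme \<Rightarrow> 'a set \<Rightarrow> 'a set \<Rightarrow> bool"
  where "acts_regularly_by_conjugation G H E \<longleftrightarrow>
    (\<forall>h\<in>H. \<forall>x\<in>E. inv\<^bsub>G\<^esub> h \<otimes>\<^bsub>G\<^esub> x \<otimes>\<^bsub>G\<^esub> h \<in> E) \<and>
    (\<forall>x\<in>E. \<forall>y\<in>E. \<exists>!h. h \<in> H \<and> inv\<^bsub>G\<^esub> h \<otimes>\<^bsub>G\<^esub> x \<otimes>\<^bsub>G\<^esub> h = y)"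

definition product_ways :: "('a, 'b) monoid_scheme \<Rightarrow> 'a set \<Rightarrow> 'a \<Rightarrow> nat"
  where "product_ways G T a = card {(y1, y2). y1 \<in> T \<and> y2 \<in> T \<and> y1 \<otimes>\<^bsub>G\<^esub> y2 = a}"

definition partial_sum_set ::
    "('a, 'b) monoid_scheme \<Rightarrow> 'a set \<Rightarrow> nat \<Rightarrow> nat \<Rightarrow> nat \<Rightarrow> nat \<Rightarrow> bool"
  where "partial_sum_set G T w k l m \<longleftrightarrow>
    group G \<and> finite (carrier G) \<and> order G = w \<and>
    T \<subseteq> carrier G \<and> card T = k \<and>
    (\<forall>a\<in>T. a \<noteq> \<one>\<^bsub>G\<^esub> \<longrightarrow> product_ways G T a = l) \<and>
    (\<forall>a\<in>carrier G - T. a \<noteq> \<one>\<^bsub>G\<^esub> \<longrightarrow> product_ways G T a = m)"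

end

theory Submission
  imports Defs
begin

text \<open>Left cosets of \<open>H\<close> correspond to the elements of \<open>K\<close>, and regularity of \<open>H\<close> on \<open>K - {\<one>}\<close>
  makes \<open>G\<close> sharply 2-transitive on them. A factorisation \<open>y\<^sub>1 y\<^sub>2 = a\<close> with \<open>y\<^sub>1 \<in> B\<close> and
  \<open>y\<^sub>2 \<in> C\<close> says that \<open>y\<^sub>1\<close> sends the pair of cosets \<open>(H, C)\<close> to \<open>(B, aH)\<close>. If \<open>C \<noteq> H\<close> there is
  one such \<open>y\<^sub>1\<close> when \<open>a \<notin> B\<close> and none otherwise; if \<open>C = H\<close> there are \<open>|H|\<close> when \<open>a \<in> B\<close> and
  none otherwise. The parameters follow by summing over all pairs of cosets.\<close>

section \<open>Left cosets and the counting of factorisations\<close>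

lemma (in group) mem_lcoset_iff:
  assumes H: "subgroup H G" and B: "B \<in> lcosets H" and x: "x \<in> B" and y: "y \<in> carrier G"
  shows "y \<in> B \<longleftrightarrow> inv x \<otimes> y \<in> H"
proof -
  obtain b where b: "b \<in> carrier G" "B = b <# H"
    using B by (auto simp: LCOSETS_def)
  have xc: "x \<in> carrier G"
    using b H x subgroup.elemlcos_carrier is_group by metis
  have "B = x <# H"
    using l_repr_independence[OF _ b(1) H] b(2) x by simp
  then show ?thesis
    using subgroup.lcos_module_imp[OF H is_group xc, of y]
      subgroup.lcos_module_rev[OF H is_group xc y] by blast
qed

text \<open>The first factor determines the second, so it suffices to count first factors.\<close>

lemma (in group) product_ways_eq_card:
  assumes T: "T \<subseteq> carrier G" and a: "a \<in> carrier G"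
  shows "product_ways G T a = card {y \<in> T. inv y \<otimes> a \<in> T}"
proof -
  have "y1 \<otimes> y2 = a \<longleftrightarrow> y2 = inv y1 \<otimes> a" if "y1 \<in> T" "y2 \<in> T" for y1 y2
    using inv_solve_left[of y2 y1 a] subsetD[OF T that(1)] subsetD[OF T that(2)] a by metis
  then have "{(y1, y2). y1 \<in> T \<and> y2 \<in> T \<and> y1 \<otimes> y2 = a}
      = {(y1, y2). y1 \<in> T \<and> y2 \<in> T \<and> y2 = inv y1 \<otimes> a}"
    by blast
  also have "\<dots> = (\<lambda>y. (y, inv y \<otimes> a)) ` {y \<in> T. inv y \<otimes> a \<in> T}"
    by auto
  finally show ?thesis
    unfolding product_ways_def by (simp add: card_image inj_on_def)
qed

text \<open>Distinct left cosets are disjoint, so each first factor \<open>y\<close> belongs to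
  exactly one pair: the coset of \<open>y\<close> and the coset of
  \<open>inv y \<otimes> a\<close>.\<close>

lemma (in group) product_ways_Union_lcosets:
  assumes fin: "finite (carrier G)" and H: "subgroup H G"
    and D: "D \<subseteq> lcosets H" and a: "a \<in> carrier G"
  shows "product_ways G (\<Union>D) a = (\<Sum>B\<in>D. \<Sum>C\<in>D. card {y \<in> B. inv y \<otimes> a \<in> C})"
proof -
  have DG: "\<Union>D \<subseteq> carrier G"
    using D lcosets_part_G[OF H] by blast
  have finD: "finite D"
    using DG fin finite_UnionD finite_subset by blast
  have fB: "finite B" if "B \<in> D" for B
    by (rule finite_subset[OF _ fin]) (use that DG in blast)
  have disj: "B \<inter> C = {}" if "B \<in> D" "C \<in> D" "B \<noteq> C" for B C
    using that D lcos_disjoint[OF H] by (auto simp: pairwise_def disjnt_def)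
  have "{y \<in> \<Union>D. inv y \<otimes> a \<in> \<Union>D} = (\<Union>B\<in>D. \<Union>C\<in>D. {y \<in> B. inv y \<otimes> a \<in> C})"
    by auto
  moreover have "card \<dots> = (\<Sum>B\<in>D. card (\<Union>C\<in>D. {y \<in> B. inv y \<otimes> a \<in> C}))"
    using finD fB disj by (intro card_UN_disjoint) (simp_all, blast)
  moreover have "card (\<Union>C\<in>D. {y \<in> B. inv y \<otimes> a \<in> C})
      = (\<Sum>C\<in>D. card {y \<in> B. inv y \<otimes> a \<in> C})" if "B \<in> D" for B
    using that finD fB disj by (intro card_UN_disjoint) (simp_all, blast)
  ultimately show ?thesis
    by (simp add: product_ways_eq_card[OF DG a])
qed

text \<open>The case where the second factor lies in \<open>H\<close>: the condition on
  \<open>y\<close> then says that \<open>a\<close> lies in the coset of \<open>y\<close>, which is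
  \<open>B\<close>, so it holds for all of \<open>B\<close> or for none of it.\<close>

lemma (in group) card_lcoset_quotients_in_subgroup:
  assumes fin: "finite (carrier G)" and H: "subgroup H G"
    and B: "B \<in> lcosets H" and a: "a \<in> carrier G"
  shows "card {y \<in> B. inv y \<otimes> a \<in> H} = (if a \<in> B then card H else 0)"
proof -
  have "{y \<in> B. inv y \<otimes> a \<in> H} = (if a \<in> B then B else {})"
    using mem_lcoset_iff[OF H B _ a] by auto
  then show ?thesis
    using l_card_cosets_equal[OF B subgroup.subset[OF H] fin] by simp
qed

section \<open>Semidirect decomposition and the regular action\<close>

lemma (in group) semidirect_decomp:
  assumes sd: "internal_semidirect G K H" and x: "x \<in> carrier G"
  obtains k h where "k \<in> K" "h \<in> H" "x = k \<otimes> h"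
  using sd x unfolding internal_semidirect_def set_mult_def by blast

lemma (in group) subgroup_mult_cancel_right:
  assumes H: "subgroup H G" and x: "x \<in> carrier G" and h: "h \<in> H"
  shows "x \<otimes> h \<in> H \<longleftrightarrow> x \<in> H"
proof
  have hc: "h \<in> carrier G"
    using H h by (rule subgroup.mem_carrier)
  assume "x \<otimes> h \<in> H"
  then have "x \<otimes> h \<otimes> inv h \<in> H"
    using H h by (simp add: subgroup.m_closed subgroup.m_inv_closed)
  then show "x \<in> H"
    using x hc by (simp add: m_assoc)
qed (use H h in \<open>simp add: subgroup.m_closed\<close>)

text \<open>Moving \<open>inv h\<close> past \<open>k\<close> turns it into the conjugate
  \<open>inv h \<otimes> k \<otimes> h\<close> followed by an element of \<open>H\<close>, which
  does not affect the left coset. Distinct elements of \<open>K\<close> lie in distinct left cosets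
  because \<open>K \<inter> H\<close> is trivial, so the conjugate can only be the representative
  \<open>k'\<close> of \<open>C\<close>.\<close>

lemma (in group) conj_mem_lcoset_iff:
  assumes sd: "internal_semidirect G K H"
    and k: "k \<in> K" "k' \<in> K" and h: "h \<in> H" "h1 \<in> H" "h2 \<in> H"
    and C: "C \<in> lcosets H" "k' \<otimes> h2 \<in> C"
  shows "inv h \<otimes> (k \<otimes> h1) \<in> C \<longleftrightarrow> inv h \<otimes> k \<otimes> h = k'"
proof -
  have K: "K \<lhd> G" and H: "subgroup H G" and KH: "K \<inter> H = {\<one>}"
    using sd by (auto simp: internal_semidirect_def)
  have Ks: "subgroup K G"
    using K by (rule normal_imp_subgroup)
  have carr: "k \<in> carrier G" "k' \<in> carrier G" "h \<in> carrier G" "h1 \<in> carrier G" "h2 \<in> carrier G"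
    using k h subgroup.mem_carrier[OF H] subgroup.mem_carrier[OF Ks] by auto
  define u where "u = inv h \<otimes> k \<otimes> h"
  have u: "u \<in> K"
    unfolding u_def using normal.inv_op_closed1[OF K carr(3) k(1)] .
  have uc: "u \<in> carrier G"
    using u subgroup.mem_carrier[OF Ks] by auto
  have k'C: "k' \<in> C"
  proof -
    have "inv (k' \<otimes> h2) \<otimes> k' = inv h2"
      using carr by (simp add: inv_mult_group m_assoc)
    then show ?thesis
      using mem_lcoset_iff[OF H C carr(2)] h subgroup.m_inv_closed[OF H] by simp
  qed
  have "inv k' \<otimes> (inv h \<otimes> (k \<otimes> h1)) = (inv k' \<otimes> u) \<otimes> (inv h \<otimes> h1)"
  proof -
    have "h \<otimes> (inv h \<otimes> h1) = h1"
      using carr by (simp add: m_assoc[symmetric])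
    then show ?thesis
      unfolding u_def using carr by (simp add: m_assoc)
  qed
  then have "inv h \<otimes> (k \<otimes> h1) \<in> C \<longleftrightarrow> (inv k' \<otimes> u) \<otimes> (inv h \<otimes> h1) \<in> H"
    using mem_lcoset_iff[OF H C(1) k'C] carr by simp
  also have "\<dots> \<longleftrightarrow> inv k' \<otimes> u \<in> H"
    using subgroup_mult_cancel_right[OF H, of "inv k' \<otimes> u" "inv h \<otimes> h1"] carr uc h
      subgroup.m_closed[OF H] subgroup.m_inv_closed[OF H] by simp
  \<comment> \<open>Normality puts \<open>u\<close> in \<open>K\<close>, so the quotient already
    lies in \<open>K\<close>; lying in \<open>H\<close> as well forces it to be the
    identity.\<close>
  also have "\<dots> \<longleftrightarrow> inv k' \<otimes> u = \<one>"
    using KH u k subgroup.m_closed[OF Ks] subgroup.m_inv_closed[OF Ks] by blast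
  also have "\<dots> \<longleftrightarrow> u = k'"
    using carr uc by (metis inv_equality inv_inv inv_closed l_inv)
  finally show ?thesis
    unfolding u_def .
qed

text \<open>With \<open>y = b \<otimes> h'\<close>, the condition says that \<open>h'\<close>
  conjugates the \<open>K\<close>-part of \<open>inv b \<otimes> a\<close> to the
  \<open>K\<close>-part of an element of \<open>C\<close>. If both parts are nontrivial, regularity
  provides exactly one such \<open>h'\<close>.\<close>

lemma (in group) card_lcoset_quotients_regular:
  assumes sd: "internal_semidirect G K H"
    and reg: "acts_regularly_by_conjugation G H (K - {\<one>})"
    and B: "B \<in> lcosets H" and C: "C \<in> lcosets H" and CH: "C \<noteq> H" and a: "a \<in> carrier G"
  shows "card {y \<in> B. inv y \<otimes> a \<in> C} = (if a \<in> B then 0 else 1)"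
proof -
  have H: "subgroup H G"
    using sd by (auto simp: internal_semidirect_def)
  have HL: "H \<in> lcosets H"
    using lcos_mult_one[OF subgroup.subset[OF H]] by (auto simp: LCOSETS_def)
  have disj: "C \<inter> H = {}"
    using lcos_disjoint[OF H] C HL CH by (auto simp: pairwise_def disjnt_def)
  show ?thesis
  proof (cases "a \<in> B")
    case True
    \<comment> \<open>When \<open>a\<close> and \<open>y\<close> share the coset \<open>B\<close>,
      their quotient lies in \<open>H\<close>, which is disjoint from \<open>C\<close>.\<close>
    then have "{y \<in> B. inv y \<otimes> a \<in> C} = {}"
      using mem_lcoset_iff[OF H B _ a] disj by blast
    then show ?thesis
      using True by (metis card.empty)
  next
    case False
    obtain b where b: "b \<in> carrier G" and Bb: "B = b <# H"
      using B by (auto simp: LCOSETS_def)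
    have bB: "b \<in> B"
      using lcos_self[OF b H] Bb by simp
    obtain c where c: "c \<in> carrier G" and cC: "c \<in> C"
      using C lcos_self H by (auto simp: LCOSETS_def)
    obtain k h1 where kh: "k \<in> K" "h1 \<in> H" "inv b \<otimes> a = k \<otimes> h1"
      using semidirect_decomp[OF sd] a b by (metis inv_closed m_closed)
    obtain k' h2 where kh': "k' \<in> K" "h2 \<in> H" "c = k' \<otimes> h2"
      using semidirect_decomp[OF sd c] by metis
    \<comment> \<open>The two exclusions match the two nontrivial parts: \<open>a \<notin> B\<close>
      gives \<open>k \<noteq> \<one>\<close>, and \<open>C \<noteq> H\<close> gives
      \<open>k' \<noteq> \<one>\<close>.\<close>
    have "inv b \<otimes> a \<notin> H"
      using False mem_lcoset_iff[OF H B bB a] by simp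
    then have "k \<noteq> \<one>"
      using kh subgroup.mem_carrier[OF H] by auto
    moreover have "k' \<noteq> \<one>"
      using kh' cC disj subgroup.mem_carrier[OF H] by auto
    ultimately obtain h where h: "h \<in> H" "inv h \<otimes> k \<otimes> h = k'"
      and uniq: "\<And>h'. h' \<in> H \<Longrightarrow> inv h' \<otimes> k \<otimes> h' = k' \<Longrightarrow> h' = h"
      using reg kh kh' unfolding acts_regularly_by_conjugation_def
      by (metis DiffI singletonD)
    have iff: "inv (b \<otimes> h') \<otimes> a \<in> C \<longleftrightarrow> h' = h" if h': "h' \<in> H" for h'
    proof -
      have "inv (b \<otimes> h') \<otimes> a = inv h' \<otimes> (k \<otimes> h1)"
        using kh(3) a b subgroup.mem_carrier[OF H h'] by (simp add: inv_mult_group m_assoc)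
      then show ?thesis
        using conj_mem_lcoset_iff[OF sd kh(1) kh'(1) h' kh(2) kh'(2) C] cC kh'(3) h uniq[OF h']
        by auto
    qed
    have "{y \<in> B. inv y \<otimes> a \<in> C} = {b \<otimes> h}"
      using iff h(1) unfolding Bb l_coset_def by auto
    then show ?thesis
      using False by simp
  qed
qed

section \<open>Sizes and sums over families of cosets\<close>

lemma (in group) card_Union_lcosets:
  assumes fin: "finite (carrier G)" and H: "subgroup H G" and D: "D \<subseteq> lcosets H"
  shows "card (\<Union>D) = card D * card H"
proof -
  have DG: "\<Union>D \<subseteq> carrier G"
    using D lcosets_part_G[OF H] by blast
  have "card H * card D = card (\<Union>D)"
  proof (rule card_partition)
    show "finite (\<Union>D)"
      using DG fin finite_subset by blast
    then show "finite D"
      by (rule finite_UnionD)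
    show "card B = card H" if "B \<in> D" for B
      using l_card_cosets_equal[OF subsetD[OF D that] subgroup.subset[OF H] fin] by simp
    show "B \<inter> C = {}" if "B \<in> D" "C \<in> D" "B \<noteq> C" for B C
      using that D lcos_disjoint[OF H] by (auto simp: pairwise_def disjnt_def)
  qed
  then show ?thesis
    by (simp add: mult.commute)
qed

text \<open>By disjointness at most one coset in \<open>D\<close> contains \<open>a\<close>, so at
  most one summand is \<open>p\<close>. The truncated \<open>card D - 1\<close> is harmless: in that
  branch \<open>D\<close> is nonempty.\<close>

lemma (in group) sum_lcosets_split:
  fixes p q :: nat
  assumes fin: "finite D" and H: "subgroup H G" and D: "D \<subseteq> lcosets H"
  shows "(\<Sum>B\<in>D. if a \<in> B then p else q) =
    (if a \<in> \<Union>D then p + (card D - 1) * q else card D * q)"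
proof (cases "a \<in> \<Union>D")
  case True
  then obtain B where B: "B \<in> D" "a \<in> B"
    by blast
  have "a \<notin> C" if "C \<in> D - {B}" for C
    using that B D lcos_disjoint[OF H] by (fastforce simp: pairwise_def disjnt_def)
  then show ?thesis
    using B True fin by (simp add: sum.remove)
next
  case False
  then have "(\<Sum>B\<in>D. if a \<in> B then p else q) = (\<Sum>B\<in>D. q)"
    by (intro sum.cong) auto
  then show ?thesis
    using False by simp
qed

section \<open>The parameters of \<open>S\<close> and \<open>S \<union> H\<close>\<close>

theorem theorem7p1:
  fixes G :: "('a, 'b) monoid_scheme" and K H S :: "'a set"
    and \<C> :: "'a set set" and t :: nat
  assumes "frobenius_group G K H"
    and "acts_regularly_by_conjugation G H (K - {\<one>\<^bsub>G\<^esub>})"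
    and "\<C> \<subseteq> lcosets\<^bsub>G\<^esub> H" and "H \<notin> \<C>" and "card \<C> = t"
    and "S = \<Union>\<C>"
  shows "partial_sum_set G S (order G) (t * card H) (t\<^sup>2 - t) (t\<^sup>2) \<and>
    partial_sum_set G (S \<union> H) (order G) ((t + 1) * card H) (t\<^sup>2 + card H) (t\<^sup>2 + t)"
proof -
  have grp: "group G" and fin: "finite (carrier G)" and sd: "internal_semidirect G K H"
    using assms(1) by (auto simp: frobenius_group_def frobenius_complement_def)
  interpret group G by fact
  have H: "subgroup H G"
    using sd by (auto simp: internal_semidirect_def)
  \<comment> \<open>As the coset of the identity, \<open>H\<close> can join the family, so
    \<open>S \<union> H\<close> is treated as a union of \<open>t + 1\<close> cosets.\<close>
  have HL: "H \<in> lcosets\<^bsub>G\<^esub> H"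
    using lcos_mult_one[OF subgroup.subset[OF H]] by (auto simp: LCOSETS_def)
  have HC: "insert H \<C> \<subseteq> lcosets\<^bsub>G\<^esub> H"
    using HL assms(3) by simp
  have SG: "S \<subseteq> carrier G" and SHG: "S \<union> H \<subseteq> carrier G"
    using assms(3,6) HL lcosets_part_G[OF H] by blast+
  have finC: "finite \<C>"
    using SG fin assms(6) finite_UnionD finite_subset by blast
  have SH: "S \<union> H = \<Union>(insert H \<C>)"
    using assms(6) by auto
  have Sc: "card S = t * card H"
    using card_Union_lcosets[OF fin H assms(3)] assms(5,6) by simp
  have SHc: "card (S \<union> H) = (t + 1) * card H"
    using card_Union_lcosets[OF fin H HC] SH finC assms(4,5) by simp
  \<comment> \<open>The first coset \<open>B\<close> is fixed and may be \<open>H\<close> itself;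
    only the second coset ranges over \<open>\<C>\<close>, where the regular count applies.\<close>
  have row: "(\<Sum>C\<in>\<C>. card {y \<in> B. inv\<^bsub>G\<^esub> y \<otimes>\<^bsub>G\<^esub> a \<in> C}) = (if a \<in> B then 0 else t)"
    if "B \<in> lcosets\<^bsub>G\<^esub> H" "a \<in> carrier G" for a B
  proof -
    have "(\<Sum>C\<in>\<C>. card {y \<in> B. inv\<^bsub>G\<^esub> y \<otimes>\<^bsub>G\<^esub> a \<in> C}) = (\<Sum>C\<in>\<C>. if a \<in> B then 0 else 1)"
    proof (intro sum.cong refl)
      fix C assume "C \<in> \<C>"
      then have "C \<in> lcosets\<^bsub>G\<^esub> H" "C \<noteq> H"
        using assms(3,4) by auto
      then show "card {y \<in> B. inv\<^bsub>G\<^esub> y \<otimes>\<^bsub>G\<^esub> a \<in> C} = (if a \<in> B then 0 else 1)"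
        using card_lcoset_quotients_regular[OF sd assms(2) that(1)] that(2) by blast
    qed
    then show ?thesis
      using assms(5) by simp
  qed
  have S_ways: "product_ways G S a = (if a \<in> S then t\<^sup>2 - t else t\<^sup>2)"
    if a: "a \<in> carrier G" for a
  proof -
    have "product_ways G S a = (\<Sum>B\<in>\<C>. if a \<in> B then 0 else t)"
      unfolding assms(6) product_ways_Union_lcosets[OF fin H assms(3) a]
      using assms(3) a by (intro sum.cong row) auto
    \<comment> \<open>For \<open>a \<in> S\<close> the coset of \<open>a\<close> contributes
      \<open>0\<close> and each of the other \<open>t - 1\<close> contributes
      \<open>t\<close>.\<close>
    also have "\<dots> = (if a \<in> S then t\<^sup>2 - t else t\<^sup>2)"
      using sum_lcosets_split[OF finC H assms(3), of a 0 t] assms(5,6)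
      by (simp add: power2_eq_square diff_mult_distrib)
    finally show ?thesis .
  qed
  have SH_ways: "product_ways G (S \<union> H) a = (if a \<in> S \<union> H then t\<^sup>2 + card H else t\<^sup>2 + t)"
    if a: "a \<in> carrier G" for a
  proof -
    \<comment> \<open>The extra second coset \<open>H\<close> adds \<open>card H\<close> exactly
      when \<open>a \<in> B\<close>, where the cosets in \<open>\<C>\<close> contribute nothing;
      otherwise it adds \<open>0\<close> to their \<open>t\<close>.\<close>
    have "product_ways G (S \<union> H) a = (\<Sum>B\<in>insert H \<C>. if a \<in> B then card H else t)"
      unfolding SH product_ways_Union_lcosets[OF fin H HC a]
    proof (intro sum.cong refl)
      fix B assume "B \<in> insert H \<C>"
      then have B: "B \<in> lcosets\<^bsub>G\<^esub> H"
        using HC by blast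
      show "(\<Sum>C\<in>insert H \<C>. card {y \<in> B. inv\<^bsub>G\<^esub> y \<otimes>\<^bsub>G\<^esub> a \<in> C}) =
          (if a \<in> B then card H else t)"
        using finC assms(4) row[OF B a] card_lcoset_quotients_in_subgroup[OF fin H B a] by simp
    qed
    \<comment> \<open>Of the \<open>t + 1\<close> first cosets, either one gives
      \<open>card H\<close> and the other \<open>t\<close> give \<open>t\<close> each, or all of
      them give \<open>t\<close>.\<close>
    also have "\<dots> = (if a \<in> S \<union> H then t\<^sup>2 + card H else t\<^sup>2 + t)"
      using sum_lcosets_split[OF _ H HC, of a "card H" t] finC assms(4,5) SH
      by (simp add: power2_eq_square)
    finally show ?thesis .
  qed
  show ?thesis
    unfolding partial_sum_set_def
    using grp fin SG SHG Sc SHc by (auto simp: S_ways SH_ways subset_iff)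
qed

end
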